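(* Let $(\Omega,R_\ast)$ be a polycrystal and suppose that the values attained by $R_\ast$ on the grains of $(\Omega,R_\ast)$ are $R_{\theta_1},\ldots,R_{\theta_N}$ with $0=\theta_1<\theta_2<\ldots<\theta_N<\pi$ and $N\geq2$. Then the Taylor bound $\mathcal T_{\mathcal N}(R_\ast(\Omega))$ is trivial, i.e. $\mathcal T_{\mathcal N}(R_\ast(\Omega))=\mathrm{SO}(2)$, if and only if there exists $n\in\{1,\ldots,N-1\}$ such that $$\frac\pi2\in[\theta_n,\theta_{n+1}]\quad\text{and}\quad\theta_{n+1}-\theta_n\leq\frac\pi2.$$
   Context: Notation: $e_1,e_2$ is the standard basis of $\mathbb R^2$, $|\cdot|$ the Euclidean norm, $R_\theta=\begin{pmatrix}\cos\theta&-\sin\theta\\ \sin\theta&\cos\theta\end{pmatrix}\in \mathrm{SO}(2)$, and $\mathcal N:=\{F\in\mathbb R^{2\times 2}:\det F=1,\ |Fe_1|\leq 1\}$. For $R\in\mathrm{SO}(2)$, $\mathcal N R^T=\{FR^T: F\in\mathcal N\}$. Polycrystal: a pair $(\Omega,R_\ast)$ such that $\Omega\subset\mathbb R^2$ is a bounded Lipschitz domain with a partition (up to a set of measure zero) into finitely many bounded Lipschitz domains $\Omega_1,\ldots,\Omega_K\subset\Omega$ (the grains), i.e. $\Omega=\mathrm{int}\bigcup_{k=1}^K\overline{\Omega}_k$ and $\mathrm{int}\,\overline{\Omega}_k=\Omega_k$ for all $k$; and $R_\ast:\Omega\to\mathrm{SO}(2)$ is constant on each $\Omega_k$, with $R_\ast|_{\Omega_k}\neq\pm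 R_\ast|_{\Omega_l}$ whenever $k\neq l$ and $\mathcal H^1(\partial\Omega_k\cap\partial\Omega_l)>0$ ($\mathcal H^1$ the one-dimensional Hausdorff measure). Taylor bound: $\mathcal T_{\mathcal N}(R_\ast(\Omega)):=\bigcap_{x\in\Omega}\mathcal N R_\ast^T(x)$, the finite intersection of the sets $\mathcal N R^T$ over all values $R$ attained by $R_\ast$ on the grains (values on the null set between the grains are disregarded). *)

theory Defs
  imports "HOL-Analysis.Analysis"
begin

definition SO2 :: "(real^2^2) set" where
  "SO2 = {R. rotation_matrix R}"

definition rot :: "real \<Rightarrow> real^2^2" where
  "rot t = vector [vector [cos t, - sin t], vector [sin t, cos t]]"

definition N_set :: "(real^2^2) set" where
  "N_set = {F. det F = 1 \<and> norm (F *v axis 1 1) \<le> 1}"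

definition taylor_bound :: "(real^2^2) set \<Rightarrow> (real^2^2) set \<Rightarrow> (real^2^2) set" where
  "taylor_bound M Q = (\<Inter>R\<in>Q. {F ** transpose R |F. F \<in> M})"

(* The library's diameter is a meaningful supremum only on bounded sets, so the covering
   sets are required to be bounded.  In dimension one the normalising constant of the
   Hausdorff measure is 1. *)
definition hausdorff1_delta :: "real \<Rightarrow> 'a::metric_space set \<Rightarrow> ennreal" where
  "hausdorff1_delta \<delta> A =
     (INF U \<in> {U :: nat \<Rightarrow> 'a set. A \<subseteq> (\<Union>i. U i) \<and>
                (\<forall>i. bounded (U i) \<and> diameter (U i) \<le> \<delta>)}.
        \<Sum>i. ennreal (diameter (U i)))"

definition hausdorff1 :: "'a::metric_space set \<Rightarrow> ennreal" where
  "hausdorff1 A = (SUP \<delta> \<in> {0<..}. hausdorff1_delta \<delta> A)"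

(* Near each boundary point the set is, in suitably rotated coordinates, the part of a ball
   lying strictly above the graph of a Lipschitz function. *)
definition bounded_lipschitz_domain :: "(real^2) set \<Rightarrow> bool" where
  "bounded_lipschitz_domain S \<longleftrightarrow>
     S \<noteq> {} \<and> open S \<and> connected S \<and> bounded S \<and>
     (\<forall>p \<in> frontier S. \<exists>r > 0. \<exists>Q :: real^2^2. \<exists>g :: real \<Rightarrow> real. \<exists>L.
        rotation_matrix Q \<and> L-lipschitz_on UNIV g \<and>
        S \<inter> ball p r = {x \<in> ball p r. g ((Q *v x) $ 1) < (Q *v x) $ 2})"

(* The grains E 1, ..., E K of the pair (Omega, R) are carried along as data.  R is a total
   function in HOL; only its restriction to Omega is constrained. *)
definition polycrystal ::
  "(real^2) set \<Rightarrow> (real^2 \<Rightarrow> real^2^2) \<Rightarrow> nat \<Rightarrow> (nat \<Rightarrow> (real^2) set) \<Rightarrow> bool" where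
  "polycrystal \<Omega> R K E \<longleftrightarrow>
     bounded_lipschitz_domain \<Omega> \<and>
     (\<forall>k\<in>{1..K}. bounded_lipschitz_domain (E k) \<and> E k \<subseteq> \<Omega> \<and>
                 interior (closure (E k)) = E k) \<and>
     (\<forall>k\<in>{1..K}. \<forall>l\<in>{1..K}. k \<noteq> l \<longrightarrow> E k \<inter> E l = {}) \<and>
     negligible (\<Omega> - (\<Union>k\<in>{1..K}. E k)) \<and>
     \<Omega> = interior (\<Union>k\<in>{1..K}. closure (E k)) \<and>
     R \<in> \<Omega> \<rightarrow> SO2 \<and>
     (\<forall>k\<in>{1..K}. R constant_on E k) \<and>
     (\<forall>k\<in>{1..K}. \<forall>l\<in>{1..K}. k \<noteq> l \<and> hausdorff1 (frontier (E k) \<inter> frontier (E l)) > 0 \<longrightarrow>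
        (\<forall>x\<in>E k. \<forall>y\<in>E l. R x \<noteq> R y \<and> R x \<noteq> - R y))"

(* Values of R on the null set between the grains are left out. *)
definition grain_rotations ::
  "(real^2 \<Rightarrow> real^2^2) \<Rightarrow> nat \<Rightarrow> (nat \<Rightarrow> (real^2) set) \<Rightarrow> (real^2^2) set" where
  "grain_rotations R K E = R ` (\<Union>k\<in>{1..K}. E k)"

end

theory Submission
  imports Defs
begin

text \<open>
  For \<open>F\<close> with \<open>det F = 1\<close> the function \<open>t \<mapsto> |F (cos t, sin t)|\<^sup>2\<close> has the form
  \<open>a + b cos 2t + c sin 2t\<close> with \<open>a \<ge> 1\<close> and \<open>a\<^sup>2 = 1 + b\<^sup>2 + c\<^sup>2\<close>, and \<open>F\<close> lies in the Taylor bound iff it is at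
  most 1 at every \<open>\<theta>\<^sub>i\<close>. If the points \<open>(cos 2\<theta>\<^sub>i, sin 2\<theta>\<^sub>i)\<close> have the origin in their convex hull,
  a convex combination of the inequalities gives \<open>a \<le> 1\<close>, so \<open>F\<close> is a rotation. Otherwise they lie in
  an open half circle, and a small stretch along the direction opposite to its centre is a non-rotation
  in the Taylor bound. The condition on \<open>\<theta>\<^sub>n, \<theta>\<^sub>n\<^sub>+\<^sub>1\<close> decides between the two cases.
\<close>

definition stretch_sq :: "real^2^2 \<Rightarrow> real \<Rightarrow> real" where
  "stretch_sq F t = (F$1$1 * cos t + F$1$2 * sin t)\<^sup>2 + (F$2$1 * cos t + F$2$2 * sin t)\<^sup>2"

lemma rot_nth [simp]:
  "rot t $ 1 $ 1 = cos t" "rot t $ 1 $ 2 = - sin t" "rot t $ 2 $ 1 = sin t" "rot t $ 2 $ 2 = cos t"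
  by (simp_all add: rot_def)

lemma det_rot [simp]: "det (rot t) = 1"
  by (simp add: det_2 flip: power2_eq_square)

lemma rot_mult_transpose:
  "rot t ** transpose (rot t) = mat 1" "transpose (rot t) ** rot t = mat 1"
  by (simp_all add: vec_eq_iff forall_2 matrix_matrix_mult_def sum_2 transpose_def mat_def
      flip: power2_eq_square)

lemma mem_N_set_rot_iff: "F ** rot t \<in> N_set \<longleftrightarrow> det F = 1 \<and> stretch_sq F t \<le> 1"
proof -
  have "norm ((F ** rot t) *v axis 1 1) = sqrt (stretch_sq F t)"
    by (simp add: norm_vec_def L2_set_def sum_2 matrix_vector_mult_def matrix_matrix_mult_def
        axis_def stretch_sq_def)
  then show ?thesis
    by (simp add: N_set_def det_mul)
qed

text \<open>Right multiplication by \<open>rot t\<close> undoes \<open>transpose (rot t)\<close>.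
  For empty \<open>I\<close> the intersection would contain every matrix.\<close>

lemma mem_taylor_bound_rot_iff:
  assumes "I \<noteq> {}"
  shows "F \<in> taylor_bound N_set ((\<lambda>i. rot (\<theta> i)) ` I) \<longleftrightarrow>
    det F = 1 \<and> (\<forall>i\<in>I. stretch_sq F (\<theta> i) \<le> 1)"
proof -
  have "(\<exists>G. F = G ** transpose (rot t) \<and> G \<in> N_set) \<longleftrightarrow> F ** rot t \<in> N_set" for t
    by (metis matrix_mul_assoc matrix_mul_rid rot_mult_transpose)
  then show ?thesis
    using assms by (auto simp: taylor_bound_def mem_N_set_rot_iff)
qed

lemma mem_SO2_iff:
  "F \<in> SO2 \<longleftrightarrow> det F = 1 \<and> (F$1$1)\<^sup>2 + (F$2$1)\<^sup>2 = 1 \<and> (F$1$2)\<^sup>2 + (F$2$2)\<^sup>2 = 1 \<and>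
    F$1$1 * F$1$2 + F$2$1 * F$2$2 = 0"
  by (auto simp: SO2_def rotation_matrix_def orthogonal_matrix vec_eq_iff forall_2
      matrix_matrix_mult_def sum_2 transpose_def mat_def power2_eq_square mult.commute)

text \<open>\<open>A\<close>, \<open>D\<close> and \<open>B\<close> are the entries of
  \<open>transpose F ** F\<close>; its quadratic form on the unit circle is affine in the point at
  the doubled angle.\<close>

lemma stretch_sq_fourier:
  assumes "A = (F$1$1)\<^sup>2 + (F$2$1)\<^sup>2" "D = (F$1$2)\<^sup>2 + (F$2$2)\<^sup>2" "B = F$1$1 * F$1$2 + F$2$1 * F$2$2"
  shows "stretch_sq F t = (A + D) / 2 + (A - D) / 2 * cos (2 * t) + B * sin (2 * t)"
proof -
  have "stretch_sq F t = A * (cos t)\<^sup>2 + D * (sin t)\<^sup>2 + B * (2 * sin t * cos t)"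
    unfolding assms stretch_sq_def by algebra
  moreover have "(cos t)\<^sup>2 = (1 + cos (2 * t)) / 2" "(sin t)\<^sup>2 = (1 - cos (2 * t)) / 2"
    "2 * sin t * cos t = sin (2 * t)"
    by (simp_all add: cos_double_cos sin_squared_eq sin_double)
  ultimately show ?thesis
    by (simp only:) (simp add: field_simps)
qed

lemma stretch_sq_SO2:
  assumes "F \<in> SO2"
  shows "stretch_sq F t = 1"
  using assms by (simp add: mem_SO2_iff stretch_sq_fourier[OF refl refl refl])

text \<open>The sum of the squared entries minus \<open>2 * det F\<close> is a sum of two squares.
  Once these vanish, \<open>F\<close> has the shape of a rotation.\<close>

lemma mem_SO2I:
  assumes det: "det F = 1" and le: "(F$1$1)\<^sup>2 + (F$2$1)\<^sup>2 + (F$1$2)\<^sup>2 + (F$2$2)\<^sup>2 \<le> 2"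
  shows "F \<in> SO2"
proof -
  have "(F$1$1 - F$2$2)\<^sup>2 + (F$1$2 + F$2$1)\<^sup>2 =
      (F$1$1)\<^sup>2 + (F$2$1)\<^sup>2 + (F$1$2)\<^sup>2 + (F$2$2)\<^sup>2 - 2 * det F"
    unfolding det_2 by algebra
  also have "\<dots> \<le> 0"
    using assms by simp
  finally have "F$1$1 = F$2$2" "F$1$2 = - F$2$1"
    by (simp_all add: sum_power2_le_zero_iff)
  with det show ?thesis
    by (simp add: mem_SO2_iff det_2 power2_eq_square)
qed

text \<open>The doubled angles 0, 2\<alpha>, 2\<beta> cut the circle into three arcs of length at
  most \<pi>, so the origin lies in the convex hull of the three points.\<close>

lemma mem_SO2_if_stretch_sq_le_1:
  assumes "det F = 1" "stretch_sq F 0 \<le> 1" "stretch_sq F \<alpha> \<le> 1" "stretch_sq F \<beta> \<le> 1"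
    and "0 \<le> \<alpha>" "\<alpha> \<le> pi / 2" "pi / 2 \<le> \<beta>" "\<beta> < pi" "\<beta> - \<alpha> \<le> pi / 2"
  shows "F \<in> SO2"
proof -
  define A D B where "A = (F$1$1)\<^sup>2 + (F$2$1)\<^sup>2" and "D = (F$1$2)\<^sup>2 + (F$2$2)\<^sup>2"
    and "B = F$1$1 * F$1$2 + F$2$1 * F$2$2"
  note q = stretch_sq_fourier[OF A_def D_def B_def]
  have "A + D \<le> 2"
  \<comment> \<open>Here the doubled angles 0 and \<pi> give antipodal points, which suffice. The
    weights of the general case may all vanish, for instance if \<alpha> = 0 and \<beta> =
    \<pi>/2.\<close>
  proof (cases "\<alpha> = pi / 2 \<or> \<beta> = pi / 2")
    case True
    then have "stretch_sq F (pi / 2) \<le> 1"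
      using assms(3,4) by metis
    with assms(2) show ?thesis
      by (simp add: q field_simps)
  next
    case False
    text \<open>The weights expressing the origin through the points at angles \<open>0\<close>, \<open>2\<alpha>\<close> and \<open>2\<beta>\<close>.\<close>
    define u v w where "u = sin (2 * \<beta> - 2 * \<alpha>)" and "v = - sin (2 * \<beta>)" and "w = sin (2 * \<alpha>)"
    have "u \<ge> 0" "w \<ge> 0"
      unfolding u_def w_def using assms by (auto intro!: sin_ge_zero)
    have "v > 0"
      unfolding v_def using assms False by (auto intro!: sin_lt_zero)
    have "u + v * cos (2 * \<alpha>) + w * cos (2 * \<beta>) = 0" "v * sin (2 * \<alpha>) + w * sin (2 * \<beta>) = 0"
      unfolding u_def v_def w_def by (simp_all add: sin_diff algebra_simps)
    then have "(u + v + w) * ((A + D) / 2) =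
        u * stretch_sq F 0 + v * stretch_sq F \<alpha> + w * stretch_sq F \<beta>"
      unfolding q by simp algebra
    also have "\<dots> \<le> u * 1 + v * 1 + w * 1"
      using assms \<open>u \<ge> 0\<close> \<open>v > 0\<close> \<open>w \<ge> 0\<close> by (intro add_mono mult_left_mono) auto
    finally have "(u + v + w) * ((A + D) / 2) \<le> (u + v + w) * 1"
      by simp
    then have "(A + D) / 2 \<le> 1"
      by (rule mult_left_le_imp_le) (use \<open>u \<ge> 0\<close> \<open>v > 0\<close> \<open>w \<ge> 0\<close> in linarith)
    then show ?thesis
      by simp
  qed
  then show ?thesis
    using \<open>det F = 1\<close> by (intro mem_SO2I) (auto simp: A_def D_def)
qed

lemma cos_squared_less_half:
  fixes x :: real
  assumes "pi / 4 < \<bar>x\<bar>" "\<bar>x\<bar> < 3 * pi / 4"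
  shows "(cos x)\<^sup>2 < 1 / 2"
proof -
  have "cos (2 * \<bar>x\<bar>) = - cos (2 * \<bar>x\<bar> - pi)"
    by simp
  also have "\<dots> < 0"
    using assms cos_gt_zero_pi[of "2 * \<bar>x\<bar> - pi"] by linarith
  also have "cos (2 * \<bar>x\<bar>) = 2 * (cos x)\<^sup>2 - 1"
    by (subst cos_double_cos) simp
  finally show ?thesis
    by simp
qed

text \<open>The bound on the cosines puts all doubled angles into the open half circle centred at
  2\<mu> + \<pi>. Finitely many such points leave room for a slight stretch along \<mu>.\<close>

lemma exists_stretch_not_mem_SO2:
  assumes "finite I" "I \<noteq> {}" and lt: "\<And>i. i \<in> I \<Longrightarrow> (cos (\<theta> i - \<mu>))\<^sup>2 < 1 / 2"
  obtains F where "det F = 1" "\<And>i. i \<in> I \<Longrightarrow> stretch_sq F (\<theta> i) \<le> 1" "F \<notin> SO2"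
proof -
  define M where "M = Max ((\<lambda>i. (cos (\<theta> i - \<mu>))\<^sup>2) ` I)"
  have M: "M < 1 / 2" "\<And>i. i \<in> I \<Longrightarrow> (cos (\<theta> i - \<mu>))\<^sup>2 \<le> M"
    unfolding M_def using assms by (subst Max_less_iff, auto)
  \<comment> \<open>For \<open>x > 1\<close>, the bound \<open>x * c + (1 - c) / x \<le> 1\<close>
    is equivalent to \<open>x * c \<le> 1 - c\<close>. This \<open>x\<close> meets it for all
    \<open>c \<le> M\<close> and avoids dividing by \<open>M\<close>, which may be 0.\<close>
  define x where "x = 2 * (1 - M)"
  define s where "s = sqrt x"
  have "x > 1"
    using M by (simp add: x_def)
  then have s: "s > 0" "s\<^sup>2 = x"
    by (auto simp: s_def)
  \<comment> \<open>This is the diagonal matrix with entries \<open>s\<close> and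
    \<open>1 / s\<close> times \<open>transpose (rot \<mu>)\<close>.\<close>
  define F :: "real^2^2" where
    "F = vector [vector [s * cos \<mu>, s * sin \<mu>], vector [- sin \<mu> / s, cos \<mu> / s]]"
  have F: "F$1$1 = s * cos \<mu>" "F$1$2 = s * sin \<mu>" "F$2$1 = - sin \<mu> / s" "F$2$2 = cos \<mu> / s"
    by (simp_all add: F_def)
  have det: "det F = 1"
    using s by (simp add: det_2 F flip: power2_eq_square)
  have q: "stretch_sq F t = x * (cos (t - \<mu>))\<^sup>2 + (sin (t - \<mu>))\<^sup>2 / x" for t
  proof -
    have "stretch_sq F t = (s * cos (t - \<mu>))\<^sup>2 + (sin (t - \<mu>) / s)\<^sup>2"
      using s by (simp add: stretch_sq_def F cos_diff sin_diff field_simps)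
    then show ?thesis
      using s by (simp add: power_mult_distrib power_divide)
  qed
  have "stretch_sq F (\<theta> i) \<le> 1" if "i \<in> I" for i
  proof -
    define c where "c = (cos (\<theta> i - \<mu>))\<^sup>2"
    have "x * c \<le> x * M"
      using M(2)[OF that] \<open>x > 1\<close> by (simp add: c_def)
    also have "\<dots> = 2 * M * (1 - M)"
      by (simp add: x_def)
    also have "\<dots> \<le> 1 * (1 - M)"
      using M(1) by (intro mult_right_mono) auto
    also have "\<dots> \<le> 1 - c"
      using M(2)[OF that] by (simp add: c_def)
    finally have "(x - 1) * (1 - c - x * c) \<ge> 0"
      using \<open>x > 1\<close> by simp
    then have "x * (x * c) + (1 - c) \<le> x"
      by (simp add: algebra_simps)
    then have "x * c + (1 - c) / x \<le> 1"
      using \<open>x > 1\<close> by (simp add: field_simps)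
    then show ?thesis
      by (simp add: q c_def sin_squared_eq)
  qed
  moreover have "F \<notin> SO2"
  proof
    assume "F \<in> SO2"
    then have "stretch_sq F \<mu> = 1"
      by (rule stretch_sq_SO2)
    with \<open>x > 1\<close> show False
      by (simp add: q)
  qed
  ultimately show ?thesis
    using det that by blast
qed

theorem corollary3p2:
  fixes \<Omega> :: "(real^2) set" and R :: "real^2 \<Rightarrow> real^2^2"
    and K :: nat and E :: "nat \<Rightarrow> (real^2) set"
    and N :: nat and \<theta> :: "nat \<Rightarrow> real"
  assumes "polycrystal \<Omega> R K E"
    and "N \<ge> 2"
    and "\<theta> 1 = 0"
    and "strict_mono_on {1..N} \<theta>"
    and "\<theta> N < pi"
    and "grain_rotations R K E = (\<lambda>i. rot (\<theta> i)) ` {1..N}"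
  shows "taylor_bound N_set (grain_rotations R K E) = SO2 \<longleftrightarrow>
    (\<exists>n\<in>{1..N-1}. pi / 2 \<in> {\<theta> n..\<theta> (n + 1)} \<and> \<theta> (n + 1) - \<theta> n \<le> pi / 2)"
proof -
  let ?T = "taylor_bound N_set (grain_rotations R K E)"
  have T_iff: "F \<in> ?T \<longleftrightarrow> det F = 1 \<and> (\<forall>i\<in>{1..N}. stretch_sq F (\<theta> i) \<le> 1)" for F
    using \<open>N \<ge> 2\<close> unfolding assms(6) by (intro mem_taylor_bound_rot_iff) auto
  have mono: "\<theta> i \<le> \<theta> j" if "i \<in> {1..N}" "j \<in> {1..N}" "i \<le> j" for i j
    using strict_mono_on_imp_mono_on[OF assms(4)] that by (rule mono_onD)
  have range: "0 \<le> \<theta> i" "\<theta> i < pi" if "i \<in> {1..N}" for i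
    using mono[of 1 i] mono[of i N] that assms(3,5) by auto
  show ?thesis
  proof
    assume "\<exists>n\<in>{1..N-1}. pi / 2 \<in> {\<theta> n..\<theta> (n + 1)} \<and> \<theta> (n + 1) - \<theta> n \<le> pi / 2"
    then obtain n where n: "n \<in> {1..N-1}" "\<theta> n \<le> pi / 2" "pi / 2 \<le> \<theta> (n + 1)"
      "\<theta> (n + 1) - \<theta> n \<le> pi / 2"
      by auto
    then have *: "1 \<in> {1..N}" "n \<in> {1..N}" "n + 1 \<in> {1..N}"
      by auto
    have "F \<in> SO2" if "F \<in> ?T" for F
      using that n(2-4) * range[of n] range[of "n + 1"]
      by (intro mem_SO2_if_stretch_sq_le_1[of F "\<theta> n" "\<theta> (n + 1)"])
        (auto simp: T_iff simp flip: \<open>\<theta> 1 = 0\<close>)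
    moreover have "F \<in> ?T" if "F \<in> SO2" for F
      using that by (auto simp: T_iff stretch_sq_SO2 mem_SO2_iff)
    ultimately show "?T = SO2"
      by blast
  next
    assume T: "?T = SO2"
    show "\<exists>n\<in>{1..N-1}. pi / 2 \<in> {\<theta> n..\<theta> (n + 1)} \<and> \<theta> (n + 1) - \<theta> n \<le> pi / 2"
    proof (rule ccontr)
      assume no: "\<not> ?thesis"
      define n where "n = Max {i \<in> {1..N}. \<theta> i \<le> pi / 2}"
      have "n \<in> {i \<in> {1..N}. \<theta> i \<le> pi / 2}"
        unfolding n_def using \<open>N \<ge> 2\<close> \<open>\<theta> 1 = 0\<close> by (intro Max_in) (auto intro!: exI[of _ 1])
      then have n: "n \<in> {1..N}" "\<theta> n \<le> pi / 2"
        by auto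
      have above: "pi / 2 < \<theta> i" if "i \<in> {1..N}" "n < i" for i
      proof (rule ccontr)
        assume "\<not> pi / 2 < \<theta> i"
        then have "i \<le> n"
          unfolding n_def using that by (intro Max_ge) auto
        with that show False
          by simp
      qed
      text \<open>The upper end of the gap above \<open>\<theta> n\<close>; beyond \<open>\<theta> N\<close> it is \<open>\<theta> 1 + pi\<close>, since
        angles matter only modulo \<open>pi\<close>.\<close>
      define m where "m = (if n = N then pi else \<theta> (n + 1))"
      have "m \<le> pi"
        using range(2)[of "n + 1"] n by (auto simp: m_def)
      have gap: "m - \<theta> n > pi / 2"
      proof (cases "n = N")
        case True
        \<comment> \<open>Otherwise the index \<open>N - 1\<close> would satisfy the condition, as
          all angles are nonnegative.\<close>
        have "\<theta> N \<noteq> pi / 2"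
        proof
          assume "\<theta> N = pi / 2"
          moreover have "N - 1 \<in> {1..N - 1}" "N - 1 + 1 = N"
            using \<open>N \<ge> 2\<close> by auto
          ultimately show False
            using no mono[of "N - 1" N] range(1)[of "N - 1"] by force
        qed
        with True n show ?thesis
          by (simp add: m_def)
      next
        case False
        then have "n \<in> {1..N - 1}" "n + 1 \<in> {1..N}"
          using n by auto
        with no n above[of "n + 1"] False show ?thesis
          by (force simp: m_def)
      qed
      \<comment> \<open>The midpoint of the gap is more than \<pi>/4 away from both ends. Its
        distance to 0 and to \<pi> is below 3\<pi>/4, which bounds its distance to every
        \<open>\<theta> i\<close>.\<close>
      define \<mu> where "\<mu> = (\<theta> n + m) / 2"
      have \<mu>: "pi / 4 < \<mu>" "\<mu> < 3 * pi / 4" "\<theta> n < \<mu> - pi / 4" "\<mu> + pi / 4 < m"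
        using gap \<open>m \<le> pi\<close> range(1)[OF n(1)] by (auto simp: \<mu>_def field_simps)
      have "(cos (\<theta> i - \<mu>))\<^sup>2 < 1 / 2" if i: "i \<in> {1..N}" for i
      proof (cases "i \<le> n")
        case True
        then have "\<theta> i \<le> \<theta> n"
          using mono i n by simp
        then show ?thesis
          using \<mu> range(1)[OF i] by (intro cos_squared_less_half) auto
      next
        case False
        then have "m \<le> \<theta> i"
          using mono[of "n + 1" i] i by (auto simp: m_def)
        then show ?thesis
          using \<mu> range(2)[OF i] by (intro cos_squared_less_half) auto
      qed
      then obtain F where "det F = 1" "\<And>i. i \<in> {1..N} \<Longrightarrow> stretch_sq F (\<theta> i) \<le> 1" "F \<notin> SO2"
        using \<open>N \<ge> 2\<close> exists_stretch_not_mem_SO2[of "{1..N}" \<theta> \<mu>] by auto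
      then show False
        using T T_iff by blast
    qed
  qed
qed

end
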